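(* Let $\mathfrak{k}$ be a compact Lie algebra and $\mathfrak{k}_{\mathcal{A}}:=C_0(X,\mathfrak{k})$ for a non-compact locally compact space $X$ countable at infinity, $\mathcal{A}=C_0(X)$. Let $(\delta_n)_{n\in\mathbb{N}}$ be an approximate identity of $\mathcal{A}$ with $0\leq\delta_n\leq 1$. Then any bounded unitary representation $\pi\colon\mathfrak{k}_{\mathcal{A}}\to\mathfrak{u}(\mathcal{H})$ extends to a bounded unitary representation of the Banach–Lie algebra $\mathfrak{k}_{\mathcal{A}_+}\cong\mathfrak{k}_{\mathcal{A}}\rtimes\mathfrak{k}$, given on $\mathfrak{k}$ by $$\hat\pi(x):=\operatorname*{s-lim}_{n\to\infty}\pi(x\otimes\delta_n)\qquad(x\in\mathfrak{k}),$$ where the limit exists in the strong operator topology.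
   Context: Locally compact spaces are Hausdorff; countable at infinity means $\sigma$-compact. $C_0(X,\mathfrak{k})\cong\mathfrak{k}\otimes_{\mathbb{R}}C_0(X,\mathbb{R})$ is the Banach–Lie algebra of continuous functions $X\to\mathfrak{k}$ vanishing at infinity, with the sup-norm and pointwise bracket. $\mathcal{A}_+=\mathbb{C}\oplus\mathcal{A}$ is the unitization of $\mathcal{A}=C_0(X)$, and $\mathfrak{k}_{\mathcal{A}_+}=\mathfrak{k}\otimes_{\mathbb{R}}(\mathcal{A}_+)_{\mathbb{R}}\cong C_0(X,\mathfrak{k})\rtimes\mathfrak{k}$, with $\mathfrak{k}\cong\mathfrak{k}\otimes\mathbf{1}$ acting pointwise, $[x,y\otimes a]=[x,y]\otimes a$. An approximate identity is a sequence $(\delta_n)$ in $C_0(X,\mathbb{R})$ with $\delta_n f\to f$ uniformly for all $f\in C_0(X)$ (such a sequence with $0\le\delta_n\le1$ exists because $X$ is countable at infinity). A bounded unitary representation is a continuous Lie algebra homomorphism into the bounded skew-hermitian operators $\mathfrak{u}(\mathcal{H})$ (norm topology) of a complex Hilbert space. *)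

theory Defs
  imports "HOL-Analysis.Analysis"
begin

section \<open>Complex Hilbert spaces and bounded skew-hermitian operators\<close>

text \<open>The inner product is antilinear in the first argument.\<close>

class complex_inner_space = real_normed_vector +
  fixes scaleC :: "complex \<Rightarrow> 'a \<Rightarrow> 'a"  (infixr \<open>*\<^sub>C\<close> 75)
    and cinner :: "'a \<Rightarrow> 'a \<Rightarrow> complex"
  assumes scaleC_add_right: "a *\<^sub>C (x + y) = a *\<^sub>C x + a *\<^sub>C y"
    and scaleC_add_left: "(a + b) *\<^sub>C x = a *\<^sub>C x + b *\<^sub>C x"
    and scaleC_scaleC: "a *\<^sub>C b *\<^sub>C x = (a * b) *\<^sub>C x"
    and scaleC_one: "1 *\<^sub>C x = x"
    and scaleR_scaleC: "r *\<^sub>R x = of_real r *\<^sub>C x"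
    and cinner_commute: "cinner x y = cnj (cinner y x)"
    and cinner_add_right: "cinner x (y + z) = cinner x y + cinner x z"
    and cinner_scaleC_right: "cinner x (a *\<^sub>C y) = a * cinner x y"
    and Re_cinner_ge_zero: "0 \<le> Re (cinner x x)"
    and norm_eq_sqrt_cinner: "norm x = sqrt (Re (cinner x x))"

class complex_hilbert_space = complex_inner_space + complete_space

text \<open>Elements of \<open>'h \<Rightarrow>\<^sub>L 'h\<close> are only real-linear, so complex linearity is part of
  the definition. The norm of \<open>'h \<Rightarrow>\<^sub>L 'h\<close> is the operator norm.\<close>

definition skew_hermitian_ops :: "('h::complex_hilbert_space \<Rightarrow>\<^sub>L 'h) set" where
  "skew_hermitian_ops = {A.
     (\<forall>c v. blinfun_apply A (c *\<^sub>C v) = c *\<^sub>C blinfun_apply A v) \<and>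
     (\<forall>v w. cinner (blinfun_apply A v) w = - cinner v (blinfun_apply A w))}"

definition commutator :: "('h::real_normed_vector \<Rightarrow>\<^sub>L 'h) \<Rightarrow> ('h \<Rightarrow>\<^sub>L 'h) \<Rightarrow> ('h \<Rightarrow>\<^sub>L 'h)" where
  "commutator A B = (A o\<^sub>L B) - (B o\<^sub>L A)"

text \<open>The normed Lie algebra is given by a subspace \<open>L\<close> of a normed space, with a bracket
  that only matters on \<open>L\<close>.\<close>

definition bounded_unitary_rep ::
    "'a::real_normed_vector set \<Rightarrow> ('a \<Rightarrow> 'a \<Rightarrow> 'a) \<Rightarrow>
     ('a \<Rightarrow> ('h::complex_hilbert_space \<Rightarrow>\<^sub>L 'h)) \<Rightarrow> bool" where
  "bounded_unitary_rep L brk \<pi> \<longleftrightarrow>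
     (\<forall>u\<in>L. \<pi> u \<in> skew_hermitian_ops) \<and>
     (\<forall>u\<in>L. \<forall>v\<in>L. \<pi> (u + v) = \<pi> u + \<pi> v) \<and>
     (\<forall>r. \<forall>u\<in>L. \<pi> (r *\<^sub>R u) = r *\<^sub>R \<pi> u) \<and>
     (\<forall>u\<in>L. \<forall>v\<in>L. \<pi> (brk u v) = commutator (\<pi> u) (\<pi> v)) \<and>
     continuous_on L \<pi>"

section \<open>Compact Lie algebras\<close>

definition lie_bracket :: "('k::real_vector \<Rightarrow> 'k \<Rightarrow> 'k) \<Rightarrow> bool" where
  "lie_bracket br \<longleftrightarrow> bilinear br \<and> (\<forall>x. br x x = 0) \<and>
     (\<forall>x y z. br x (br y z) + br y (br z x) + br z (br x y) = 0)"

text \<open>A compact Lie algebra is a finite-dimensional real Lie algebra admitting an invariant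
  inner product \<open>ip\<close>; it may have a centre. The form \<open>ip\<close> is unrelated to the norm of \<open>'k\<close>,
  which is arbitrary.\<close>

definition compact_lie_algebra :: "('k::real_normed_vector \<Rightarrow> 'k \<Rightarrow> 'k) \<Rightarrow> bool" where
  "compact_lie_algebra br \<longleftrightarrow> lie_bracket br \<and>
     (\<exists>B::'k set. finite B \<and> span B = UNIV) \<and>
     (\<exists>ip::'k \<Rightarrow> 'k \<Rightarrow> real. bilinear ip \<and> (\<forall>x y. ip x y = ip y x) \<and>
        (\<forall>x. x \<noteq> 0 \<longrightarrow> ip x x > 0) \<and>
        (\<forall>x y z. ip (br x y) z = - ip y (br x z)))"

section \<open>Continuous functions vanishing at infinity\<close>

text \<open>\<open>C\<^sub>0(X, V)\<close> as a subspace of the bounded continuous functions, whose norm is the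
  sup-norm.\<close>

definition C0 :: "('x::topological_space \<Rightarrow>\<^sub>C 'v::real_normed_vector) set" where
  "C0 = {f. \<forall>e>0. \<exists>K. compact K \<and> (\<forall>p. p \<notin> K \<longrightarrow> norm (apply_bcontfun f p) < e)}"

text \<open>The functions to which \<open>Bcontfun\<close> is applied below are indeed bounded and continuous, for the
  bracket of a finite-dimensional Lie algebra: see \<open>tensor_apply\<close>, \<open>bracket_C0_apply\<close> and
  \<open>act_C0_apply\<close>.\<close>

definition tensor ::
    "'k::real_normed_vector \<Rightarrow> ('x::topological_space \<Rightarrow>\<^sub>C real) \<Rightarrow> ('x \<Rightarrow>\<^sub>C 'k)" where
  "tensor x a = Bcontfun (\<lambda>p. apply_bcontfun a p *\<^sub>R x)"

definition bracket_C0 ::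
    "('k::real_normed_vector \<Rightarrow> 'k \<Rightarrow> 'k) \<Rightarrow>
     ('x::topological_space \<Rightarrow>\<^sub>C 'k) \<Rightarrow> ('x \<Rightarrow>\<^sub>C 'k) \<Rightarrow> ('x \<Rightarrow>\<^sub>C 'k)" where
  "bracket_C0 br f g = Bcontfun (\<lambda>p. br (apply_bcontfun f p) (apply_bcontfun g p))"

definition act_C0 ::
    "('k::real_normed_vector \<Rightarrow> 'k \<Rightarrow> 'k) \<Rightarrow>
     'k \<Rightarrow> ('x::topological_space \<Rightarrow>\<^sub>C 'k) \<Rightarrow> ('x \<Rightarrow>\<^sub>C 'k)" where
  "act_C0 br x g = Bcontfun (\<lambda>p. br x (apply_bcontfun g p))"

text \<open>The Lie algebra of the unitization is the semidirect product \<open>C\<^sub>0(X, \<kk>) \<rtimes> \<kk>\<close>: its carrier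
  is \<open>C0 \<times> UNIV\<close>, where \<open>(f, x)\<close> stands for \<open>f + x \<otimes> \<one>\<close>. The norm of the product type induces
  the product topology.\<close>

definition bracket_semidirect ::
    "('k::real_normed_vector \<Rightarrow> 'k \<Rightarrow> 'k) \<Rightarrow>
     ('x::topological_space \<Rightarrow>\<^sub>C 'k) \<times> 'k \<Rightarrow> ('x \<Rightarrow>\<^sub>C 'k) \<times> 'k \<Rightarrow> ('x \<Rightarrow>\<^sub>C 'k) \<times> 'k" where
  "bracket_semidirect br = (\<lambda>(f, x) (g, y).
     (bracket_C0 br f g + act_C0 br x g - act_C0 br y f, br x y))"

definition approximate_identity :: "(nat \<Rightarrow> ('x::topological_space \<Rightarrow>\<^sub>C real)) \<Rightarrow> bool" where
  "approximate_identity \<delta> \<longleftrightarrow> (\<forall>n. \<delta> n \<in> C0) \<and>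
     (\<forall>f \<in> (C0 :: ('x \<Rightarrow>\<^sub>C complex) set).
        uniform_limit UNIV (\<lambda>n p. of_real (apply_bcontfun (\<delta> n) p) * apply_bcontfun f p)
          (apply_bcontfun f) sequentially)"

definition sigma_compact_space :: "'x::topological_space itself \<Rightarrow> bool" where
  "sigma_compact_space _ \<longleftrightarrow> (\<exists>K::nat \<Rightarrow> 'x set. (\<forall>n. compact (K n)) \<and> (\<Union>n. K n) = UNIV)"

section \<open>Well-definedness of the pointwise operations\<close>

lemma tensor_apply: "apply_bcontfun (tensor x a) p = apply_bcontfun a p *\<^sub>R x"
proof -
  have "bounded ((\<lambda>r. r *\<^sub>R x) ` range (apply_bcontfun a))"
    by (intro bounded_linear_image bounded_linear_scaleR_left bounded_apply_bcontfun)
  then have "(\<lambda>p. apply_bcontfun a p *\<^sub>R x) \<in> bcontfun"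
    by (auto simp: bcontfun_def image_image intro!: continuous_intros)
  then show ?thesis by (simp add: tensor_def Bcontfun_inverse)
qed

lemma finite_dim_coordinates_bounded:
  fixes B :: "'k::real_normed_vector set"
  assumes "finite B" "independent B"
  obtains C where "\<And>c b. b \<in> B \<Longrightarrow> \<bar>c b\<bar> \<le> C * norm (\<Sum>b\<in>B. c b *\<^sub>R b)"
proof -
  define F where "F = (\<lambda>c::'k \<Rightarrow> real. \<Sum>b\<in>B. c b *\<^sub>R b)"
  define S where "S b0 = (\<Pi>\<^sub>E b\<in>UNIV. if b = b0 then {1} else if b \<in> B then {-1..1} else {0::real})"
    for b0 :: 'k
  have contF: "continuous_on A (\<lambda>c. norm (F c))" for A
    unfolding F_def by (intro continuous_intros continuous_on_product_coordinates
        continuous_on_subset[OF continuous_on_product_coordinates]) auto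
  have compS: "compact (S b0)" for b0
  proof -
    have "compactin (product_topology (\<lambda>i. euclidean) UNIV) (S b0)"
      unfolding S_def by (subst compactin_PiE) auto
    then show ?thesis by (simp add: euclidean_product_topology)
  qed
  have "\<exists>m>0. \<forall>c\<in>S b0. m \<le> norm (F c)" if "b0 \<in> B" for b0
  proof -
    have "S b0 \<noteq> {}" by (auto simp: S_def PiE_eq_empty_iff)
    then obtain c0 where c0: "c0 \<in> S b0" "\<forall>c\<in>S b0. norm (F c0) \<le> norm (F c)"
      using continuous_attains_inf[OF compS _ contF] by blast
    have "c0 b0 = 1" using c0(1) by (auto simp: S_def PiE_iff dest!: spec[of _ b0])
    then have "F c0 \<noteq> 0"
      using independentD[OF assms(2,1) subset_refl _ that, of c0] unfolding F_def by auto
    then show ?thesis using c0(2) by (intro exI[of _ "norm (F c0)"]) auto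
  qed
  then obtain m where m: "\<And>b0. b0 \<in> B \<Longrightarrow> m b0 > 0"
    "\<And>b0 c. b0 \<in> B \<Longrightarrow> c \<in> S b0 \<Longrightarrow> m b0 \<le> norm (F c)"
    by metis
  define C where "C = (\<Sum>b\<in>B. 1 / m b)"
  have C: "1 / m b \<le> C" if "b \<in> B" for b
    unfolding C_def using assms(1) that m(1) by (intro member_le_sum) (auto simp: less_imp_le)
  have "\<bar>c b\<bar> \<le> C * norm (F c)" if bB: "b \<in> B" for c b
  proof -
    obtain b0 where b0: "b0 \<in> B" "\<And>b. b \<in> B \<Longrightarrow> \<bar>c b\<bar> \<le> \<bar>c b0\<bar>"
    proof -
      have "Max ((\<lambda>b. \<bar>c b\<bar>) ` B) \<in> (\<lambda>b. \<bar>c b\<bar>) ` B" using assms(1) bB by (intro Max_in) auto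
      then obtain b0 where b0: "b0 \<in> B" "Max ((\<lambda>b. \<bar>c b\<bar>) ` B) = \<bar>c b0\<bar>" by auto
      show ?thesis
      proof (rule that[of b0])
        fix b assume "b \<in> B"
        then show "\<bar>c b\<bar> \<le> \<bar>c b0\<bar>" unfolding b0(2)[symmetric] using assms(1) by (intro Max_ge) auto
      qed (rule b0)
    qed
    have "\<bar>c b0\<bar> \<le> C * norm (F c)"
    proof (cases "c b0 = 0")
      case True
      have "0 \<le> C" using C[OF b0(1)] m(1)[OF b0(1)] by (smt (verit) zero_less_divide_1_iff)
      then show ?thesis using True by simp
    next
      case False
      define d where "d = (\<lambda>b. if b \<in> B then c b / c b0 else 0)"
      have "\<bar>d b\<bar> \<le> 1" if "b \<in> B" for b
        using b0(2)[OF that] False that by (simp add: d_def abs_divide)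
      then have "d \<in> S b0"
        using b0(1) False by (auto simp: S_def PiE_iff abs_le_iff minus_le_iff)
          (auto simp: d_def)
      then have 1: "m b0 \<le> norm (F d)" using m b0 by blast
      have "F d = (1 / c b0) *\<^sub>R F c"
        unfolding F_def d_def scaleR_sum_right by (intro sum.cong) auto
      then have "m b0 * \<bar>c b0\<bar> \<le> norm (F c)"
        using 1 False by (simp add: field_simps)
      then have "\<bar>c b0\<bar> \<le> 1 / m b0 * norm (F c)"
        using m(1)[OF b0(1)] by (simp add: field_simps)
      also have "\<dots> \<le> C * norm (F c)" by (intro mult_right_mono C b0) auto
      finally show ?thesis .
    qed
    then show ?thesis using b0(2)[OF bB] by linarith
  qed
  then show ?thesis using that unfolding F_def by blast
qed

lemma bounded_bilinear_finite_dim: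
  fixes h :: "'k::real_normed_vector \<Rightarrow> 'k \<Rightarrow> 'w::real_normed_vector"
  assumes h: "bilinear h" and fin: "\<exists>B::'k set. finite B \<and> span B = UNIV"
  shows "bounded_bilinear h"
proof -
  obtain B :: "'k set" where B: "finite B" "independent B" "span B = UNIV"
  proof -
    obtain B0 :: "'k set" where "finite B0" "span B0 = UNIV" using fin by blast
    moreover obtain B where "B \<subseteq> B0" "independent B" "B0 \<subseteq> span B"
      by (rule maximal_independent_subset)
    ultimately show ?thesis
      by (metis finite_subset span_mono span_span top.extremum_uniqueI that)
  qed
  obtain C where C: "\<And>c b. b \<in> B \<Longrightarrow> \<bar>c b\<bar> \<le> C * norm (\<Sum>b\<in>B. c b *\<^sub>R b)"
    using finite_dim_coordinates_bounded[OF B(1,2)] by blast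
  define r where "r = representation B"
  have r: "(\<Sum>b\<in>B. r v b *\<^sub>R b) = v" for v
    unfolding r_def using B by (intro real_vector.sum_representation_eq) auto
  have rb: "\<bar>r v b\<bar> \<le> C * norm v" if "b \<in> B" for v b
    using C[OF that, of "r v"] by (simp add: r)
  have hsum: "h u v = (\<Sum>(a, b)\<in>B \<times> B. h (r u a *\<^sub>R a) (r v b *\<^sub>R b))" for u v
    using bilinear_sum[OF h, of "\<lambda>a. r u a *\<^sub>R a" B "\<lambda>b. r v b *\<^sub>R b" B] by (simp add: r)
  show ?thesis
  proof
    show "\<exists>K. \<forall>u v. norm (h u v) \<le> norm u * norm v * K"
    proof (intro exI allI)
      fix u v
      have "norm (h u v) \<le> (\<Sum>(a, b)\<in>B \<times> B. norm (h (r u a *\<^sub>R a) (r v b *\<^sub>R b)))"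
        unfolding hsum[of u v] by (rule order_trans[OF norm_sum]) (simp add: split_def)
      also have "\<dots> \<le> (\<Sum>(a, b)\<in>B \<times> B. (C * norm u) * ((C * norm v) * norm (h a b)))"
      proof (intro sum_mono, clarsimp)
        fix a b assume ab: "a \<in> B" "b \<in> B"
        have "norm (h (r u a *\<^sub>R a) (r v b *\<^sub>R b)) = \<bar>r u a\<bar> * (\<bar>r v b\<bar> * norm (h a b))"
          using h by (simp add: bilinear_lmul bilinear_rmul abs_mult)
        also have "\<dots> \<le> (C * norm u) * ((C * norm v) * norm (h a b))"
          using rb[OF ab(1), of u] rb[OF ab(2), of v]
            order_trans[OF abs_ge_zero rb[OF ab(1), of u]]
          by (intro mult_mono[of _ _ "_ * norm (h a b)"] mult_right_mono) simp_all
        finally show "norm (h (r u a *\<^sub>R a) (r v b *\<^sub>R b))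
            \<le> C * norm u * (C * norm v * norm (h a b))" .
      qed
      also have "\<dots> = norm u * norm v * (\<Sum>(a, b)\<in>B \<times> B. C * C * norm (h a b))"
        by (simp add: sum_distrib_left split_def algebra_simps)
      finally show "norm (h u v) \<le> norm u * norm v * (\<Sum>(a, b)\<in>B \<times> B. C * C * norm (h a b))" .
    qed
  qed (use h in \<open>simp_all add: bilinear_ladd bilinear_radd bilinear_lmul bilinear_rmul\<close>)
qed

lemma compact_lie_algebra_bounded_bilinear:
  "compact_lie_algebra br \<Longrightarrow> bounded_bilinear br"
  by (auto simp: compact_lie_algebra_def lie_bracket_def intro!: bounded_bilinear_finite_dim)

lemma bracket_C0_apply:
  assumes "compact_lie_algebra br"
  shows "apply_bcontfun (bracket_C0 br f g) p = br (apply_bcontfun f p) (apply_bcontfun g p)"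
proof -
  interpret bounded_bilinear br by (rule compact_lie_algebra_bounded_bilinear[OF assms])
  obtain K where K: "\<And>a b. norm (br a b) \<le> norm a * norm b * K" "0 \<le> K"
    using nonneg_bounded by blast
  have "bounded (range (\<lambda>p. br (apply_bcontfun f p) (apply_bcontfun g p)))"
    unfolding bounded_iff
  proof (intro exI ballI, clarsimp)
    fix p
    show "norm (br (apply_bcontfun f p) (apply_bcontfun g p)) \<le> norm f * norm g * K"
      by (rule order_trans[OF K(1)]) (intro mult_right_mono mult_mono norm_bounded K(2), auto)
  qed
  then have "(\<lambda>p. br (apply_bcontfun f p) (apply_bcontfun g p)) \<in> bcontfun"
    by (auto simp: bcontfun_def intro!: continuous_on)
  then show ?thesis by (simp add: bracket_C0_def Bcontfun_inverse)
qed

lemma act_C0_apply: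
  assumes "compact_lie_algebra br"
  shows "apply_bcontfun (act_C0 br x g) p = br x (apply_bcontfun g p)"
proof -
  have "act_C0 br x g = bracket_C0 br (const_bcontfun x) g"
    by (simp add: act_C0_def bracket_C0_def const_bcontfun.rep_eq)
  then show ?thesis by (simp add: bracket_C0_apply[OF assms] const_bcontfun.rep_eq)
qed

end

theory Submission
  imports Defs
begin

text \<open>Strong convergence uses only that \<open>F \<mapsto> \<pi> (x \<otimes> F) v\<close> is a bounded linear map \<open>T\<close> from
  \<open>C\<^sub>0(X, \<real>)\<close> to a Hilbert space. If \<open>T \<delta>\<^sub>n\<close> were not Cauchy, differences \<open>g = \<delta>\<^sub>m - \<delta>\<^sub>n\<close> with
  \<open>norm (T g) \<ge> e\<close> would occur with \<open>m, n\<close> arbitrarily large, hence with \<open>g\<close> small wherever a given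
  \<open>F\<close> is not small. Adding such differences one after another with suitable signs keeps the
  sup-norm below 2, while by the parallelogram law a good choice of sign increases \<open>(norm (T F))\<^sup>2\<close>
  by at least \<open>e\<^sup>2\<close> at each step, contradicting boundedness. The bracket relations of the extension
  follow from \<open>[x \<otimes> \<delta>\<^sub>n, g] \<rightarrow> x \<cdot> g\<close> in sup-norm and \<open>x \<cdot> (y \<otimes> \<delta>\<^sub>n) = [x, y] \<otimes> \<delta>\<^sub>n\<close>.\<close>

section \<open>Closure properties of \<open>C0\<close> and pure tensors\<close>

text \<open>A single criterion that serves scalar multiples, tensors, the action of the
  finite-dimensional algebra and the bracket: each of these is dominated pointwise by a constant
  multiple of a function in \<open>C0\<close>.\<close>

lemma C0_dominated:
  assumes g: "g \<in> C0" and le: "\<And>p. norm (apply_bcontfun f p) \<le> C * norm (apply_bcontfun g p)"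
  shows "f \<in> C0"
  unfolding C0_def
proof (intro CollectI allI impI)
  fix e :: real assume "e > 0"
  \<comment> \<open>\<open>C\<close> may be zero or negative, so the division is by
    \<open>\<bar>C\<bar> + 1\<close>.\<close>
  then have "e / (\<bar>C\<bar> + 1) > 0" by simp
  then obtain K where K: "compact K" "\<And>p. p \<notin> K \<Longrightarrow> norm (apply_bcontfun g p) < e / (\<bar>C\<bar> + 1)"
    using g unfolding C0_def by blast
  have "norm (apply_bcontfun f p) < e" if "p \<notin> K" for p
  proof -
    have "norm (apply_bcontfun f p) \<le> (\<bar>C\<bar> + 1) * norm (apply_bcontfun g p)"
      by (rule order_trans[OF le]) (intro mult_right_mono, auto)
    also have "\<dots> < e" using K(2)[OF that] by (simp add: field_simps)
    finally show ?thesis .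
  qed
  with K(1) show "\<exists>K. compact K \<and> (\<forall>p. p \<notin> K \<longrightarrow> norm (apply_bcontfun f p) < e)" by blast
qed

lemma C0_scaleR: "f \<in> C0 \<Longrightarrow> r *\<^sub>R f \<in> C0"
  by (rule C0_dominated[of f _ "\<bar>r\<bar>"]) auto

lemma C0_add:
  assumes "f \<in> C0" "g \<in> C0"
  shows "f + g \<in> C0"
  unfolding C0_def
proof (intro CollectI allI impI)
  fix e :: real assume "e > 0"
  then have e2: "e / 2 > 0" by simp
  obtain K where K: "compact K" "\<And>p. p \<notin> K \<Longrightarrow> norm (apply_bcontfun f p) < e / 2"
    using assms(1) e2 unfolding C0_def by blast
  obtain L where L: "compact L" "\<And>p. p \<notin> L \<Longrightarrow> norm (apply_bcontfun g p) < e / 2"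
    using assms(2) e2 unfolding C0_def by blast
  have "norm (apply_bcontfun (f + g) p) < e" if "p \<notin> K \<union> L" for p
    using K(2)[of p] L(2)[of p] that norm_triangle_ineq[of "apply_bcontfun f p" "apply_bcontfun g p"]
    by (auto simp: plus_bcontfun.rep_eq)
  with K(1) L(1) show "\<exists>K. compact K \<and> (\<forall>p. p \<notin> K \<longrightarrow> norm (apply_bcontfun (f + g) p) < e)"
    by (intro exI[of _ "K \<union> L"]) auto
qed

lemma C0_diff: "f \<in> C0 \<Longrightarrow> g \<in> C0 \<Longrightarrow> f - g \<in> C0"
  using C0_add[of f "(-1) *\<^sub>R g"] C0_scaleR[of g "-1"] by simp

lemma tensor_in_C0: "a \<in> C0 \<Longrightarrow> tensor x a \<in> C0"
  by (rule C0_dominated[of a _ "norm x"]) (simp_all add: tensor_apply mult.commute)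

lemma norm_tensor_le: "norm (tensor x a) \<le> norm x * norm a"
proof (rule norm_bound)
  fix p
  show "norm (apply_bcontfun (tensor x a) p) \<le> norm x * norm a"
    using mult_left_mono[OF norm_bounded[of a p], of "norm x"]
    by (simp add: tensor_apply mult.commute)
qed

lemma tensor_add_left: "tensor (x + y) a = tensor x a + tensor y a"
  by (rule bcontfun_eqI) (simp add: tensor_apply plus_bcontfun.rep_eq scaleR_add_right)

lemma tensor_scaleR_left: "tensor (r *\<^sub>R x) a = r *\<^sub>R tensor x a"
  by (rule bcontfun_eqI) (simp add: tensor_apply)

lemma tensor_add_right: "tensor x (a + b) = tensor x a + tensor x b"
  by (rule bcontfun_eqI) (simp add: tensor_apply plus_bcontfun.rep_eq scaleR_add_left)

lemma tensor_diff_right: "tensor x (a - b) = tensor x a - tensor x b"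
  by (rule bcontfun_eqI) (simp add: tensor_apply minus_bcontfun.rep_eq scaleR_diff_left)

lemma act_C0_in_C0:
  assumes "compact_lie_algebra br" "g \<in> C0"
  shows "act_C0 br x g \<in> C0"
proof -
  interpret bounded_bilinear br by (rule compact_lie_algebra_bounded_bilinear[OF assms(1)])
  obtain K where K: "\<And>a b. norm (br a b) \<le> norm a * norm b * K" using bounded by blast
  show ?thesis
    by (rule C0_dominated[OF assms(2), of _ "norm x * K"])
      (use K in \<open>simp add: act_C0_apply[OF assms(1)] mult_ac\<close>)
qed

lemma bracket_C0_in_C0:
  assumes "compact_lie_algebra br" "f \<in> C0" "g \<in> C0"
  shows "bracket_C0 br f g \<in> C0"
proof -
  interpret bounded_bilinear br by (rule compact_lie_algebra_bounded_bilinear[OF assms(1)])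
  obtain K where K: "\<And>a b. norm (br a b) \<le> norm a * norm b * K" "0 \<le> K"
    using nonneg_bounded by blast
  show ?thesis
  proof (rule C0_dominated[OF assms(3), of _ "norm f * K"])
    fix p
    have "norm (apply_bcontfun f p) * norm (apply_bcontfun g p) * K
        \<le> norm f * norm (apply_bcontfun g p) * K"
      by (intro mult_right_mono norm_bounded K(2)) auto
    then show "norm (apply_bcontfun (bracket_C0 br f g) p) \<le> norm f * K * norm (apply_bcontfun g p)"
      using K(1)[of "apply_bcontfun f p" "apply_bcontfun g p"]
      by (simp add: bracket_C0_apply[OF assms(1)] mult_ac)
  qed
qed

text \<open>It suffices to apply the definition to the scalar function \<open>p \<mapsto> norm (f p)\<close>.\<close>

lemma approximate_identityD:
  fixes f :: "'x::topological_space \<Rightarrow>\<^sub>C 'v::real_normed_vector"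
  assumes ai: "approximate_identity \<delta>" and f: "f \<in> C0" and e: "e > 0"
  shows "\<forall>\<^sub>F n in sequentially.
    \<forall>p. norm (apply_bcontfun (\<delta> n) p *\<^sub>R apply_bcontfun f p - apply_bcontfun f p) < e"
proof -
  define h :: "'x \<Rightarrow>\<^sub>C complex" where "h = Bcontfun (\<lambda>p. of_real (norm (apply_bcontfun f p)))"
  have "(\<lambda>p. complex_of_real (norm (apply_bcontfun f p))) \<in> bcontfun"
    by (rule bcontfun_normI[where b = "norm f"]) (auto intro!: continuous_intros norm_bounded)
  then have h: "apply_bcontfun h p = of_real (norm (apply_bcontfun f p))" for p
    by (simp add: h_def Bcontfun_inverse)
  have "h \<in> C0" using f by (simp add: C0_def h)
  then have "\<forall>\<^sub>F n in sequentially. \<forall>p\<in>UNIV.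
      dist (of_real (apply_bcontfun (\<delta> n) p) * apply_bcontfun h p) (apply_bcontfun h p) < e"
    using ai e unfolding approximate_identity_def uniform_limit_iff by blast
  then show ?thesis
  proof eventually_elim
    case (elim n)
    show ?case
    proof
      fix p
      have "norm (apply_bcontfun (\<delta> n) p *\<^sub>R apply_bcontfun f p - apply_bcontfun f p)
          = norm ((apply_bcontfun (\<delta> n) p - 1) *\<^sub>R apply_bcontfun f p)"
        by (simp add: scaleR_diff_left)
      \<comment> \<open>The factor \<open>\<delta> n p - 1\<close> is real, so it scales the vector
        \<open>f p\<close> and the number \<open>norm (f p)\<close> to values of equal norm. This
        carries the estimate for \<open>h\<close> over to \<open>f\<close>.\<close>
      also have "\<dots> = norm (complex_of_real ((apply_bcontfun (\<delta> n) p - 1) * norm (apply_bcontfun f p)))"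
        by (simp only: norm_scaleR norm_of_real abs_mult abs_norm_cancel)
      also have "\<dots> < e"
        using elim by (simp add: h dist_norm left_diff_distrib)
      finally show "norm (apply_bcontfun (\<delta> n) p *\<^sub>R apply_bcontfun f p - apply_bcontfun f p) < e" .
    qed
  qed
qed

section \<open>Norm identities and continuity of the inner product\<close>

lemma power2_norm_add:
  fixes u v :: "'h::complex_inner_space"
  shows "(norm (u + v))\<^sup>2 = (norm u)\<^sup>2 + (norm v)\<^sup>2 + 2 * Re (cinner u v)"
proof -
  have n2: "(norm w)\<^sup>2 = Re (cinner w w)" for w :: 'h
    by (simp add: norm_eq_sqrt_cinner Re_cinner_ge_zero)
  have "cinner (u + v) w = cinner u w + cinner v w" for w
    by (metis cinner_commute cinner_add_right complex_cnj_add)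
  moreover have "Re (cinner v u) = Re (cinner u v)"
    by (subst cinner_commute) simp
  ultimately show ?thesis by (simp add: n2 cinner_add_right)
qed

lemma cinner_zero_right: "cinner u (0 :: 'h::complex_inner_space) = 0"
  using cinner_add_right[of u 0 0] by simp

lemma cinner_minus_right: "cinner u (- v :: 'h::complex_inner_space) = - cinner u v"
  using cinner_add_right[of u v "- v"] by (simp add: cinner_zero_right eq_neg_iff_add_eq_0 add.commute)

lemma power2_norm_diff:
  fixes u v :: "'h::complex_inner_space"
  shows "(norm (u - v))\<^sup>2 = (norm u)\<^sup>2 + (norm v)\<^sup>2 - 2 * Re (cinner u v)"
  using power2_norm_add[of u "- v"] by (simp add: cinner_minus_right)

text \<open>The class only fixes the norm through the inner product. This identity makes
  multiplication by a fixed complex number a bounded real-linear map, hence continuous.\<close>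

lemma norm_scaleC: "norm (c *\<^sub>C v :: 'h::complex_inner_space) = norm c * norm v"
proof -
  have "cinner (c *\<^sub>C v) w = cnj c * cinner v w" for w
    by (metis cinner_commute cinner_scaleC_right complex_cnj_mult complex_cnj_cnj)
  then have "cinner (c *\<^sub>C v) (c *\<^sub>C v) = of_real ((norm c)\<^sup>2) * cinner v v"
    by (simp add: cinner_scaleC_right mult_ac flip: complex_norm_square)
  then show ?thesis
    by (simp add: norm_eq_sqrt_cinner[of "c *\<^sub>C v"] norm_eq_sqrt_cinner[of v] real_sqrt_mult)
qed

lemma tendsto_scaleC:
  fixes f :: "'b \<Rightarrow> 'h::complex_inner_space"
  assumes "(f \<longlongrightarrow> l) F"
  shows "((\<lambda>n. c *\<^sub>C f n) \<longlongrightarrow> c *\<^sub>C l) F"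
proof -
  have "bounded_linear (\<lambda>v::'h. c *\<^sub>C v)"
    by (rule bounded_linear_intro[where K = "norm c"])
      (simp_all add: scaleC_add_right scaleR_scaleC scaleC_scaleC norm_scaleC mult.commute)
  from bounded_linear.tendsto[OF this assms] show ?thesis .
qed

text \<open>By polarization the real part is a combination of squared norms. The imaginary part
  reduces to a real part after multiplying the second argument by the imaginary unit.\<close>

lemma tendsto_cinner:
  fixes f g :: "'b \<Rightarrow> 'h::complex_inner_space"
  assumes f: "(f \<longlongrightarrow> l) F" and g: "(g \<longlongrightarrow> m) F"
  shows "((\<lambda>n. cinner (f n) (g n)) \<longlongrightarrow> cinner l m) F"
proof -
  have Re: "Re (cinner u v) = ((norm (u + v))\<^sup>2 - (norm (u - v))\<^sup>2) / 4" for u v :: 'h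
    by (simp add: power2_norm_add power2_norm_diff)
  have Im: "Im (cinner u v) = - Re (cinner u (\<i> *\<^sub>C v))" for u v :: 'h
    by (simp add: cinner_scaleC_right)
  have *: "((\<lambda>n. Re (cinner (f n) (h n))) \<longlongrightarrow> Re (cinner l k)) F" if "(h \<longlongrightarrow> k) F" for h k
    unfolding Re by (intro tendsto_intros f that) auto
  show ?thesis
    by (intro tendsto_complex_iff[THEN iffD2] conjI *[OF g])
      (unfold Im, intro tendsto_minus * tendsto_scaleC g)
qed

section \<open>Convergence of bounded linear maps along an approximate identity\<close>

text \<open>Intended for \<open>T F = \<pi> (tensor x F) v\<close>, which is linear and bounded on
  \<open>C0\<close> only, so the conditions on \<open>T\<close> are restricted to that subspace. The
  parallelogram law is what ties the argument to inner product spaces.\<close>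

lemma approximate_identity_Cauchy:
  fixes T :: "('x::topological_space \<Rightarrow>\<^sub>C real) \<Rightarrow> 'h::complex_inner_space"
  assumes ai: "approximate_identity \<delta>"
    and \<delta>: "\<And>n p. 0 \<le> apply_bcontfun (\<delta> n) p \<and> apply_bcontfun (\<delta> n) p \<le> 1"
    and add: "\<And>f g. f \<in> C0 \<Longrightarrow> g \<in> C0 \<Longrightarrow> T (f + g) = T f + T g"
    and diff: "\<And>f g. f \<in> C0 \<Longrightarrow> g \<in> C0 \<Longrightarrow> T (f - g) = T f - T g"
    and bound: "\<And>f. f \<in> C0 \<Longrightarrow> norm (T f) \<le> M * norm f"
  shows "Cauchy (\<lambda>n. T (\<delta> n))"
proof (rule ccontr)
  assume "\<not> Cauchy (\<lambda>n. T (\<delta> n))"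
  then obtain e where e: "e > 0" "\<And>N. \<exists>m\<ge>N. \<exists>n\<ge>N. e \<le> norm (T (\<delta> m) - T (\<delta> n))"
    unfolding Cauchy_def dist_norm by (meson not_less)
  have \<delta>C: "\<delta> n \<in> C0" for n using ai by (simp add: approximate_identity_def)
  \<comment> \<open>The strict inequality is essential for the induction: every step uses up only
    part of the remaining gap between \<open>norm F\<close> and 2.\<close>
  have "\<exists>F\<in>C0. norm F < 2 \<and> real N * e\<^sup>2 \<le> (norm (T F))\<^sup>2" for N
  proof (induction N)
    case 0
    have "0 \<in> (C0 :: ('x \<Rightarrow>\<^sub>C real) set)" using C0_scaleR[OF \<delta>C, of 0] by simp
    then show ?case by (intro bexI[of _ 0]) auto
  next
    case (Suc N)
    then obtain F where F: "F \<in> C0" "norm F < 2" "real N * e\<^sup>2 \<le> (norm (T F))\<^sup>2" by blast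
    \<comment> \<open>At most half the gap \<open>2 - norm F\<close>, and at most
      \<open>1 / 2\<close>, so that both \<open>norm F + \<eta>\<close> and
      \<open>1 + \<eta>\<close> stay below 2.\<close>
    define \<eta> where "\<eta> = min ((2 - norm F) / 2) (1 / 2)"
    have \<eta>: "0 < \<eta>" "norm F + \<eta> < 2" "1 + \<eta> < 2" using F(2) by (auto simp: \<eta>_def min_def field_simps)
    \<comment> \<open>The errors for the two indices \<open>m\<close> and \<open>n\<close> add up to
      less than \<open>\<eta>\<^sup>2\<close>, which bounds the product of \<open>g\<close> and
      \<open>F\<close> everywhere.\<close>
    have "\<eta>\<^sup>2 / 2 > 0" using \<eta>(1) by simp
    then have "\<exists>N0. \<forall>n\<ge>N0. \<forall>p.
        norm (apply_bcontfun (\<delta> n) p *\<^sub>R apply_bcontfun F p - apply_bcontfun F p) < \<eta>\<^sup>2 / 2"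
      using approximate_identityD[OF ai F(1)] unfolding eventually_sequentially by blast
    then obtain N0 where N0: "\<And>n p. n \<ge> N0 \<Longrightarrow>
        \<bar>apply_bcontfun (\<delta> n) p * apply_bcontfun F p - apply_bcontfun F p\<bar> < \<eta>\<^sup>2 / 2"
      by auto
    obtain m n where mn: "m \<ge> N0" "n \<ge> N0" "e \<le> norm (T (\<delta> m) - T (\<delta> n))" using e(2) by blast
    define g where "g = \<delta> m - \<delta> n"
    have gC: "g \<in> C0" unfolding g_def by (intro C0_diff \<delta>C)
    \<comment> \<open>The functions \<open>F\<close> and \<open>g\<close> are almost disjoint. Where
      \<open>F\<close> has size at least \<eta>, the bound on the product forces \<open>g\<close>
      below \<eta>; elsewhere \<open>F\<close> is below \<eta>, and \<open>g\<close> is at most 1 as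
      a difference of two values in the unit interval.\<close>
    have le: "\<bar>apply_bcontfun F p\<bar> + \<bar>apply_bcontfun g p\<bar> \<le> max (norm F + \<eta>) (1 + \<eta>)" for p
    proof (cases "\<eta> \<le> \<bar>apply_bcontfun F p\<bar>")
      case True
      have "\<bar>apply_bcontfun g p\<bar> * \<eta> \<le> \<bar>apply_bcontfun g p\<bar> * \<bar>apply_bcontfun F p\<bar>"
        by (intro mult_left_mono True) auto
      also have "\<dots> = \<bar>apply_bcontfun g p * apply_bcontfun F p\<bar>" by (simp add: abs_mult)
      also have "\<dots> < \<eta>\<^sup>2"
        using N0[OF mn(1), of p] N0[OF mn(2), of p]
        unfolding g_def minus_bcontfun.rep_eq left_diff_distrib by linarith
      finally have "\<bar>apply_bcontfun g p\<bar> < \<eta>" using \<eta>(1) by (simp add: power2_eq_square)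
      then show ?thesis using norm_bounded[of F p] by simp
    next
      case False
      have "\<bar>apply_bcontfun g p\<bar> \<le> 1"
        using \<delta>[of m p] \<delta>[of n p] by (auto simp: g_def minus_bcontfun.rep_eq)
      then show ?thesis using False by simp
    qed
    have "norm (F + g) \<le> max (norm F + \<eta>) (1 + \<eta>)"
    proof (rule norm_bound)
      fix p
      show "norm (apply_bcontfun (F + g) p) \<le> max (norm F + \<eta>) (1 + \<eta>)"
        unfolding plus_bcontfun.rep_eq real_norm_def by (rule order_trans[OF abs_triangle_ineq le])
    qed
    then have plus: "norm (F + g) < 2" using \<eta> by simp
    have "norm (F - g) \<le> max (norm F + \<eta>) (1 + \<eta>)"
    proof (rule norm_bound)
      fix p
      show "norm (apply_bcontfun (F - g) p) \<le> max (norm F + \<eta>) (1 + \<eta>)"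
        unfolding minus_bcontfun.rep_eq real_norm_def by (rule order_trans[OF abs_triangle_ineq4 le])
    qed
    then have minus: "norm (F - g) < 2" using \<eta> by simp
    have "e \<le> norm (T g)" using mn(3) by (simp add: g_def diff \<delta>C)
    then have "e\<^sup>2 \<le> (norm (T g))\<^sup>2" using e(1) by (intro power_mono) auto
    \<comment> \<open>Parallelogram law: the average of the two squares on the left is
      \<open>(norm (T F))\<^sup>2 + (norm (T g))\<^sup>2\<close>, so at least one choice of sign
      gains \<open>e\<^sup>2\<close>.\<close>
    moreover have "(norm (T (F + g)))\<^sup>2 + (norm (T (F - g)))\<^sup>2 = 2 * (norm (T F))\<^sup>2 + 2 * (norm (T g))\<^sup>2"
      by (simp add: add diff F(1) gC power2_norm_add power2_norm_diff)
    ultimately have "real (Suc N) * e\<^sup>2 \<le> (norm (T (F + g)))\<^sup>2 \<or> real (Suc N) * e\<^sup>2 \<le> (norm (T (F - g)))\<^sup>2"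
      using F(3) by (simp add: distrib_right) linarith
    then show ?case using plus minus C0_add[OF F(1) gC] C0_diff[OF F(1) gC] by blast
  qed
  moreover obtain N where N: "(\<bar>M\<bar> * 2)\<^sup>2 < real N * e\<^sup>2"
    using reals_Archimedean3[of "e\<^sup>2"] e(1) by auto
  ultimately obtain F where F: "F \<in> C0" "norm F < 2" "real N * e\<^sup>2 \<le> (norm (T F))\<^sup>2" by blast
  have "norm (T F) \<le> \<bar>M\<bar> * 2"
    by (rule order_trans[OF bound[OF F(1)]]) (use F(2) in \<open>intro mult_mono, auto\<close>)
  then have "(norm (T F))\<^sup>2 \<le> (\<bar>M\<bar> * 2)\<^sup>2" by (intro power_mono) auto
  then show False using N F(3) by linarith
qed

section \<open>Norm bounds, skew-hermitian sums and sup-norm limits\<close>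

text \<open>A representation is only required to be continuous on the subspace \<open>C0\<close>.
  Continuity at 0 together with real homogeneity turns this into a linear norm bound.\<close>

lemma bounded_unitary_rep_bound:
  fixes \<pi> :: "('x::topological_space \<Rightarrow>\<^sub>C 'k::real_normed_vector) \<Rightarrow> ('h::complex_hilbert_space \<Rightarrow>\<^sub>L 'h)"
  assumes "bounded_unitary_rep C0 brk \<pi>"
  obtains M where "0 \<le> M" "\<And>f. f \<in> C0 \<Longrightarrow> norm (\<pi> f) \<le> M * norm f"
proof -
  have scale: "\<pi> (r *\<^sub>R f) = r *\<^sub>R \<pi> f" if "f \<in> C0" for r f
    using assms that unfolding bounded_unitary_rep_def by blast
  have z: "0 \<in> (C0 :: ('x \<Rightarrow>\<^sub>C 'k) set)"
    by (auto simp: C0_def intro: exI[of _ "{}"])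
  have "continuous_on C0 \<pi>" using assms unfolding bounded_unitary_rep_def by blast
  then obtain d where d: "d > 0" "\<And>f. f \<in> C0 \<Longrightarrow> dist f 0 < d \<Longrightarrow> dist (\<pi> f) (\<pi> 0) < 1"
    unfolding continuous_on_iff using z by (metis zero_less_one)
  have \<pi>0: "\<pi> 0 = 0" using scale[OF z, of 0] by simp
  show ?thesis
  proof (rule that[of "2 / d"])
    fix f :: "'x \<Rightarrow>\<^sub>C 'k" assume f: "f \<in> C0"
    show "norm (\<pi> f) \<le> 2 / d * norm f"
    proof (cases "f = 0")
      case False
      \<comment> \<open>Rescales \<open>f\<close> to norm \<open>d / 2\<close>, inside the ball
        given by continuity at 0.\<close>
      define r where "r = d / (2 * norm f)"
      have r: "r > 0" using False d(1) by (simp add: r_def)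
      have "dist (r *\<^sub>R f) 0 < d" using False d(1) by (simp add: r_def)
      from d(2)[OF C0_scaleR[OF f] this] have "r * norm (\<pi> f) < 1"
        using r by (simp add: \<pi>0 scale[OF f])
      then show ?thesis using False d(1) by (simp add: r_def field_simps)
    qed (simp add: \<pi>0)
  qed (use d in simp)
qed

lemma skew_hermitian_ops_add:
  assumes "A \<in> skew_hermitian_ops" "B \<in> skew_hermitian_ops"
  shows "A + B \<in> skew_hermitian_ops"
proof -
  have "cinner (u + v) w = cinner u w + cinner v w" for u v w :: 'a
    by (metis cinner_commute cinner_add_right complex_cnj_add)
  with assms show ?thesis
    by (simp add: skew_hermitian_ops_def blinfun.add_left scaleC_add_right cinner_add_right)
qed

text \<open>Pointwise estimates pass to the sup-norm only as non-strict inequalities, hence a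
  convergence criterion with \<open>\<le> e\<close>.\<close>

lemma LIMSEQ_norm_leI:
  fixes X :: "nat \<Rightarrow> 'a::real_normed_vector"
  assumes "\<And>e. e > 0 \<Longrightarrow> \<forall>\<^sub>F n in sequentially. norm (X n - L) \<le> e"
  shows "X \<longlonglongrightarrow> L"
proof (rule tendstoI)
  fix e :: real assume "e > 0"
  then show "\<forall>\<^sub>F n in sequentially. dist (X n) L < e"
    using assms[of "e / 2"] by (auto simp: dist_norm elim!: eventually_mono)
qed

section \<open>Construction of the extension to the semidirect product\<close>

theorem proposition6p8:
  fixes br :: "'k::real_normed_vector \<Rightarrow> 'k \<Rightarrow> 'k"
    and \<delta> :: "nat \<Rightarrow> ('x::t2_space \<Rightarrow>\<^sub>C real)"
    and \<pi> :: "('x \<Rightarrow>\<^sub>C 'k) \<Rightarrow> ('h::complex_hilbert_space \<Rightarrow>\<^sub>L 'h)"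
  assumes "compact_lie_algebra br"
    and "locally_compact_space (euclidean :: 'x topology)"
    and "sigma_compact_space TYPE('x)"
    and "\<not> compact (UNIV :: 'x set)"
    and "approximate_identity \<delta>"
    and "\<And>n p. 0 \<le> apply_bcontfun (\<delta> n) p \<and> apply_bcontfun (\<delta> n) p \<le> 1"
    and "bounded_unitary_rep C0 (bracket_C0 br) \<pi>"
  shows "\<exists>\<pi>h :: ('x \<Rightarrow>\<^sub>C 'k) \<times> 'k \<Rightarrow> ('h \<Rightarrow>\<^sub>L 'h).
           bounded_unitary_rep (C0 \<times> UNIV) (bracket_semidirect br) \<pi>h \<and>
           (\<forall>f\<in>C0. \<pi>h (f, 0) = \<pi> f) \<and>
           (\<forall>x v. (\<lambda>n. blinfun_apply (\<pi> (tensor x (\<delta> n))) v)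
                    \<longlonglongrightarrow> blinfun_apply (\<pi>h (0, x)) v)"
proof -
  note br = assms(1) and ai = assms(5) and rep = assms(7)
  interpret br: bounded_bilinear br by (rule compact_lie_algebra_bounded_bilinear[OF br])
  have \<pi>_add: "\<pi> (f + g) = \<pi> f + \<pi> g" if "f \<in> C0" "g \<in> C0" for f g
    using rep that unfolding bounded_unitary_rep_def by blast
  have \<pi>_scale: "\<pi> (r *\<^sub>R f) = r *\<^sub>R \<pi> f" if "f \<in> C0" for r f
    using rep that unfolding bounded_unitary_rep_def by blast
  have \<pi>_diff: "\<pi> (f - g) = \<pi> f - \<pi> g" if "f \<in> C0" "g \<in> C0" for f g
    using \<pi>_add[OF that(1) C0_scaleR[OF that(2), of "-1"]] \<pi>_scale[OF that(2), of "-1"] by simp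
  have \<pi>_comm: "\<pi> (bracket_C0 br f g) = commutator (\<pi> f) (\<pi> g)" if "f \<in> C0" "g \<in> C0" for f g
    using rep that unfolding bounded_unitary_rep_def by blast
  have \<pi>_skew: "\<pi> f \<in> skew_hermitian_ops" if "f \<in> C0" for f
    using rep that unfolding bounded_unitary_rep_def by blast
  have \<pi>_cont: "continuous_on C0 \<pi>" using rep unfolding bounded_unitary_rep_def by blast
  obtain M where M: "0 \<le> M" "\<And>f. f \<in> C0 \<Longrightarrow> norm (\<pi> f) \<le> M * norm f"
    using bounded_unitary_rep_bound[OF rep] by blast
  have \<delta>C: "\<delta> n \<in> C0" for n using ai by (simp add: approximate_identity_def)
  note tC = tensor_in_C0[OF \<delta>C]
  have \<delta>1: "norm (\<delta> n) \<le> 1" for n by (rule norm_bound) (simp add: assms(6))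
  have \<pi>t: "norm (\<pi> (tensor x (\<delta> n))) \<le> M * norm x" for x n
  proof -
    have "norm (tensor x (\<delta> n)) \<le> norm x * 1"
      by (rule order_trans[OF norm_tensor_le]) (intro mult_left_mono \<delta>1, simp)
    then have "M * norm (tensor x (\<delta> n)) \<le> M * norm x" using M(1) by (intro mult_left_mono) auto
    then show ?thesis using M(2)[OF tC, of x n] by linarith
  qed
  \<comment> \<open>Since the functions \<open>\<delta> n\<close> have norm at most 1, the bound is
    independent of \<open>n\<close>. It therefore survives the limit and later bounds both the
    operator \<open>s x\<close> and the map \<open>S\<close>.\<close>
  have \<pi>tv: "norm (\<pi> (tensor x (\<delta> n)) v) \<le> norm v * (M * norm x)" for x n v
    using mult_right_mono[OF \<pi>t, of "norm v" x n] norm_blinfun[of "\<pi> (tensor x (\<delta> n))" v]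
    by (simp add: mult.commute)
  have "convergent (\<lambda>n. \<pi> (tensor x (\<delta> n)) v)" for x v
  proof (rule Cauchy_convergent,
      rule approximate_identity_Cauchy[OF ai assms(6), where M = "M * norm x * norm v"])
    fix f g :: "'x \<Rightarrow>\<^sub>C real" assume fg: "f \<in> C0" "g \<in> C0"
    show "\<pi> (tensor x (f + g)) v = \<pi> (tensor x f) v + \<pi> (tensor x g) v"
      by (simp add: tensor_add_right \<pi>_add tensor_in_C0 fg blinfun.add_left)
    show "\<pi> (tensor x (f - g)) v = \<pi> (tensor x f) v - \<pi> (tensor x g) v"
      by (simp add: tensor_diff_right \<pi>_diff tensor_in_C0 fg blinfun.diff_left)
  next
    fix f :: "'x \<Rightarrow>\<^sub>C real" assume f: "f \<in> C0"
    have "norm (\<pi> (tensor x f) v) \<le> norm (\<pi> (tensor x f)) * norm v" by (rule norm_blinfun)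
    also have "\<dots> \<le> M * (norm x * norm f) * norm v"
      by (intro mult_right_mono order_trans[OF M(2)[OF tensor_in_C0[OF f]]] mult_left_mono
          norm_tensor_le M(1)) auto
    finally show "norm (\<pi> (tensor x f) v) \<le> M * norm x * norm v * norm f" by (simp add: mult_ac)
  qed
  then obtain s where s: "\<And>x v. (\<lambda>n. \<pi> (tensor x (\<delta> n)) v) \<longlonglongrightarrow> s x v"
    unfolding convergent_def by metis
  have s_bl: "bounded_linear (s x)" for x
  proof (rule bounded_linear_intro)
    fix v w r
    show "s x (v + w) = s x v + s x w"
      by (rule LIMSEQ_unique[OF s]) (simp add: blinfun.add_right tendsto_add[OF s s])
    show "s x (r *\<^sub>R v) = r *\<^sub>R s x v"
      by (rule LIMSEQ_unique[OF s]) (simp add: blinfun.scaleR_right tendsto_scaleR[OF tendsto_const s])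
    show "norm (s x v) \<le> norm v * (M * norm x)"
      by (rule LIMSEQ_le_const2[OF tendsto_norm[OF s]]) (use \<pi>tv in auto)
  qed
  define S where "S x = Blinfun (s x)" for x
  have S_apply: "blinfun_apply (S x) v = s x v" for x v by (simp add: S_def bounded_linear_Blinfun_apply s_bl)
  have S: "(\<lambda>n. \<pi> (tensor x (\<delta> n)) v) \<longlonglongrightarrow> S x v" for x v using s by (simp add: S_apply)
  have S_add: "S (x + y) = S x + S y" for x y
    by (rule blinfun_eqI, rule LIMSEQ_unique[OF S])
      (simp add: tensor_add_left \<pi>_add tC blinfun.add_left tendsto_add[OF S S])
  have S_scale: "S (r *\<^sub>R x) = r *\<^sub>R S x" for r x
    by (rule blinfun_eqI, rule LIMSEQ_unique[OF S])
      (simp add: tensor_scaleR_left \<pi>_scale tC blinfun.scaleR_left tendsto_scaleR[OF tendsto_const S])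
  \<comment> \<open>Although \<open>S x\<close> is only a strong limit, this estimate makes
    \<open>S\<close> continuous for the operator norm, as a bounded representation requires.\<close>
  have S_norm: "norm (S x) \<le> norm x * M" for x
  proof (rule norm_blinfun_bound)
    show "norm (S x v) \<le> norm x * M * norm v" for v
      by (rule LIMSEQ_le_const2[OF tendsto_norm[OF S]]) (use \<pi>tv in \<open>auto simp: mult_ac\<close>)
  qed (use M(1) in simp)
  have "bounded_linear S" by (rule bounded_linear_intro[OF S_add S_scale S_norm])
  then have S_cont: "continuous_on UNIV S" by (rule linear_continuous_on)

  \<comment> \<open>Complex linearity and skewness are identities tested on vectors, so they pass to
    the strong limit.\<close>
  have SC: "\<pi> (tensor x (\<delta> n)) (c *\<^sub>C v) = c *\<^sub>C \<pi> (tensor x (\<delta> n)) v" for x n c v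
    using \<pi>_skew[OF tC] by (simp add: skew_hermitian_ops_def)
  have SI: "cinner (\<pi> (tensor x (\<delta> n)) v) w = - cinner v (\<pi> (tensor x (\<delta> n)) w)" for x n v w
    using \<pi>_skew[OF tC] by (simp add: skew_hermitian_ops_def)
  have S_skew: "S x \<in> skew_hermitian_ops" for x
    unfolding skew_hermitian_ops_def
  proof (intro CollectI conjI allI)
    fix c v w
    show "S x (c *\<^sub>C v) = c *\<^sub>C S x v"
      by (rule LIMSEQ_unique[OF S]) (simp add: SC tendsto_scaleC S)
    have "(\<lambda>n. cinner (\<pi> (tensor x (\<delta> n)) v) w) \<longlonglongrightarrow> - cinner v (S x w)"
      unfolding SI by (intro tendsto_minus tendsto_cinner tendsto_const S)
    then show "cinner (S x v) w = - cinner v (S x w)"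
      by (rule LIMSEQ_unique[OF tendsto_cinner[OF S tendsto_const]])
  qed

  \<comment> \<open>The commutators of \<open>\<pi> (tensor x (\<delta> n))\<close> with
    \<open>\<pi> g\<close> have two limits: a strong one, by definition of \<open>S\<close>, and one
    in operator norm, by continuity of \<pi>. Comparing them on each vector gives the
    relation.\<close>
  have S_\<pi>: "commutator (S x) (\<pi> g) = \<pi> (act_C0 br x g)" if g: "g \<in> C0" for x g
  proof -
    note aC = act_C0_in_C0[OF br g]
    have bC: "bracket_C0 br (tensor x (\<delta> n)) g \<in> C0" for n by (rule bracket_C0_in_C0[OF br tC g])
    \<comment> \<open>Pointwise, the bracket of \<open>tensor x (\<delta> n)\<close> with
      \<open>g\<close> is \<open>\<delta> n\<close> times \<open>act_C0 br x g\<close>, so the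
      approximate identity is applied to \<open>act_C0 br x g\<close>.\<close>
    have "(\<lambda>n. bracket_C0 br (tensor x (\<delta> n)) g) \<longlonglongrightarrow> act_C0 br x g"
    proof (rule LIMSEQ_norm_leI)
      fix e :: real assume "e > 0"
      have "\<forall>\<^sub>F n in sequentially. \<forall>p. norm (apply_bcontfun (\<delta> n) p *\<^sub>R apply_bcontfun (act_C0 br x g) p
          - apply_bcontfun (act_C0 br x g) p) < e"
        by (rule approximate_identityD[OF ai aC \<open>e > 0\<close>])
      then show "\<forall>\<^sub>F n in sequentially. norm (bracket_C0 br (tensor x (\<delta> n)) g - act_C0 br x g) \<le> e"
      proof eventually_elim
        case (elim n)
        show ?case
          by (rule norm_bound) (use elim in \<open>simp add: less_imp_le minus_bcontfun.rep_eq
            bracket_C0_apply[OF br] act_C0_apply[OF br] tensor_apply br.scaleR_left\<close>)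
      qed
    qed
    then have lim: "(\<lambda>n. \<pi> (bracket_C0 br (tensor x (\<delta> n)) g)) \<longlonglongrightarrow> \<pi> (act_C0 br x g)"
      by (rule continuous_on_tendsto_compose[OF \<pi>_cont _ aC]) (simp add: bC)
    show ?thesis
    proof (rule blinfun_eqI)
      fix v
      have "(\<lambda>n. \<pi> (tensor x (\<delta> n)) (\<pi> g v) - \<pi> g (\<pi> (tensor x (\<delta> n)) v))
          \<longlonglongrightarrow> S x (\<pi> g v) - \<pi> g (S x v)"
        by (intro tendsto_diff S blinfun.tendsto tendsto_const)
      moreover have "(\<lambda>n. \<pi> (bracket_C0 br (tensor x (\<delta> n)) g) v) \<longlonglongrightarrow> \<pi> (act_C0 br x g) v"
        by (intro blinfun.tendsto lim tendsto_const)
      ultimately show "commutator (S x) (\<pi> g) v = \<pi> (act_C0 br x g) v"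
        by (intro LIMSEQ_unique)
          (simp_all add: \<pi>_comm[OF tC g] commutator_def blinfun.diff_left)
    qed
  qed
  \<comment> \<open>The limit in the first factor has already been taken in \<open>S_\<pi>\<close>.
    Applying that relation to \<open>tensor y (\<delta> n)\<close> leaves a single limit in
    \<open>n\<close>, so no product of two varying operators has to be controlled.\<close>
  have S_S: "commutator (S x) (S y) = S (br x y)" for x y
  proof (rule blinfun_eqI)
    fix v
    have act: "act_C0 br x (tensor y (\<delta> n)) = tensor (br x y) (\<delta> n)" for n
      by (rule bcontfun_eqI) (simp add: act_C0_apply[OF br] tensor_apply br.scaleR_right)
    have "(\<lambda>n. S x (\<pi> (tensor y (\<delta> n)) v) - \<pi> (tensor y (\<delta> n)) (S x v))
        \<longlonglongrightarrow> S x (S y v) - S y (S x v)"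
      by (intro tendsto_diff S blinfun.tendsto tendsto_const)
    moreover have "S x (\<pi> (tensor y (\<delta> n)) v) - \<pi> (tensor y (\<delta> n)) (S x v)
        = \<pi> (tensor (br x y) (\<delta> n)) v" for n
      unfolding act[symmetric] S_\<pi>[OF tC, symmetric] by (simp add: commutator_def blinfun.diff_left)
    ultimately have "S x (S y v) - S y (S x v) = S (br x y) v"
      using LIMSEQ_unique[OF _ S] by auto
    then show "commutator (S x) (S y) v = S (br x y) v" by (simp add: commutator_def blinfun.diff_left)
  qed

  define \<pi>h where "\<pi>h = (\<lambda>(f, x). \<pi> f + S x)"
  have \<pi>h: "\<pi>h (f, x) = \<pi> f + S x" for f x by (simp add: \<pi>h_def)
  have "bounded_unitary_rep (C0 \<times> UNIV) (bracket_semidirect br) \<pi>h"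
    unfolding bounded_unitary_rep_def
  proof (intro conjI ballI allI)
    fix u :: "('x \<Rightarrow>\<^sub>C 'k) \<times> 'k" and r
    assume "u \<in> C0 \<times> UNIV"
    then obtain f x where u: "u = (f, x)" "f \<in> C0" by auto
    show "\<pi>h u \<in> skew_hermitian_ops"
      using skew_hermitian_ops_add[OF \<pi>_skew[OF u(2)] S_skew] by (simp add: u(1) \<pi>h)
    show "\<pi>h (r *\<^sub>R u) = r *\<^sub>R \<pi>h u"
      by (simp add: u(1) \<pi>h \<pi>_scale u(2) S_scale scaleR_add_right)
    fix v :: "('x \<Rightarrow>\<^sub>C 'k) \<times> 'k"
    assume "v \<in> C0 \<times> UNIV"
    then obtain g y where v: "v = (g, y)" "g \<in> C0" by auto
    show "\<pi>h (u + v) = \<pi>h u + \<pi>h v"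
      by (simp add: u(1) v(1) \<pi>h \<pi>_add u(2) v(2) S_add)
    \<comment> \<open>The minus sign matches the mixed term of \<open>\<pi> f\<close> and
      \<open>S y\<close>, whose commutator is the negative of
      \<open>commutator (S y) (\<pi> f)\<close>.\<close>
    have "\<pi>h (bracket_semidirect br u v) =
        commutator (\<pi> f) (\<pi> g) + commutator (S x) (\<pi> g) - commutator (S y) (\<pi> f) + commutator (S x) (S y)"
      by (simp add: u v bracket_semidirect_def \<pi>h \<pi>_add \<pi>_diff C0_add bracket_C0_in_C0[OF br]
          act_C0_in_C0[OF br] \<pi>_comm S_\<pi> S_S)
    also have "\<dots> = commutator (\<pi>h u) (\<pi>h v)"
      by (simp add: u(1) v(1) \<pi>h commutator_def
          bounded_bilinear.add_left[OF bounded_bilinear_blinfun_compose]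
          bounded_bilinear.add_right[OF bounded_bilinear_blinfun_compose])
    finally show "\<pi>h (bracket_semidirect br u v) = commutator (\<pi>h u) (\<pi>h v)" .
  next
    show "continuous_on (C0 \<times> UNIV) \<pi>h"
      unfolding \<pi>h_def split_def
      by (intro continuous_on_add continuous_on_compose2[OF \<pi>_cont] continuous_on_compose2[OF S_cont]
          continuous_intros) auto
  qed
  \<comment> \<open>The values at 0 identify \<open>\<pi>h (f, 0)\<close> with
    \<open>\<pi> f\<close> and \<open>\<pi>h (0, x)\<close> with \<open>S x\<close>.\<close>
  moreover have "\<pi> 0 = 0" using \<pi>_scale[OF tC, of 0] by simp
  moreover have "S 0 = 0" using S_scale[of 0 0] by simp
  ultimately show ?thesis using S by (intro exI[of _ \<pi>h]) (simp add: \<pi>h)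
qed

end
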